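(* Let $(V,V^+)$ be an ordered $*$-vector space with order unit $e$, and let $\|\cdot\|$ denote the order seminorm on $V_h$. Define the decomposition seminorm $\|\cdot\|_{\mathrm{dec}} : V\to[0,\infty)$ by $$\|v\|_{\mathrm{dec}} := \inf \left\{ \left\| \sum_{i=1}^n |\lambda_i|p_i \right\| : n\in\mathbb{N},\ v = \sum_{i=1}^n \lambda_i p_i \text{ with } p_i \in V^+ \text{ and } \lambda_i \in \mathbb{C} \right\}.$$ Then the decomposition seminorm $\|\cdot\|_{\mathrm{dec}}$ is an order seminorm on $V$.
   Context: A $*$-vector space is a complex vector space $V$ with a conjugate-linear involution $*:V\to V$; $V_h:=\{x\in V: x^*=x\}$. An ordered $*$-vector space $(V,V^+)$ is a $*$-vector space $V$ with a nonempty subset $V^+\subseteq V_h$ closed under addition and under multiplication by scalars in $[0,\infty)$, such that $V^+\cap -V^+=\{0\}$. For $v,w\in V_h$ write $v\ge w$ if $v-w\in V^+$. An element $e\in V_h$ is an order unit if for every $x\in V_h$ there is a real $r>0$ with $re\ge x$. The order seminorm on $V_h$ (determined by $e$) is $\|v\|:=\inf\{r\in\mathbb{R}: re+v\ge0\text{ and }re-v\ge0\}$. An order seminorm on $V$ is a complex seminorm $|||\cdot|||$ on $V$ such that $|||v^*|||=|||v|||$ for all $v\in V$ and $|||v|||=\|v\|$ for all $v\in V_h$. *)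

theory Defs
  imports Complex_Main
begin

locale star_vector_space = vector_space scale
  for scale :: "complex \<Rightarrow> 'v::ab_group_add \<Rightarrow> 'v" +
  fixes star :: "'v \<Rightarrow> 'v"
  assumes star_add: "star (x + y) = star x + star y"
    and star_scale: "star (scale c x) = scale (cnj c) (star x)"
    and star_star: "star (star x) = x"

definition hermitian :: "('v \<Rightarrow> 'v) \<Rightarrow> 'v set" where
  "hermitian star = {x. star x = x}"

locale ordered_star_vector_space = star_vector_space scale star
  for scale :: "complex \<Rightarrow> 'v::ab_group_add \<Rightarrow> 'v" and star :: "'v \<Rightarrow> 'v" +
  fixes Vpos :: "'v set"
  assumes pos_nonempty: "Vpos \<noteq> {}"
    and pos_hermitian: "Vpos \<subseteq> hermitian star"
    and pos_add: "x \<in> Vpos \<Longrightarrow> y \<in> Vpos \<Longrightarrow> x + y \<in> Vpos"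
    and pos_scale: "0 \<le> r \<Longrightarrow> x \<in> Vpos \<Longrightarrow> scale (complex_of_real r) x \<in> Vpos"
    and pos_proper: "Vpos \<inter> uminus ` Vpos = {0}"

definition ge_pos :: "'v::ab_group_add set \<Rightarrow> 'v \<Rightarrow> 'v \<Rightarrow> bool" where
  "ge_pos Vpos v w \<longleftrightarrow> v - w \<in> Vpos"

definition order_unit ::
  "(complex \<Rightarrow> 'v::ab_group_add \<Rightarrow> 'v) \<Rightarrow> ('v \<Rightarrow> 'v) \<Rightarrow> 'v set \<Rightarrow> 'v \<Rightarrow> bool" where
  "order_unit scale star Vpos e \<longleftrightarrow>
    e \<in> hermitian star \<and>
    (\<forall>x \<in> hermitian star. \<exists>r::real. r > 0 \<and> ge_pos Vpos (scale (complex_of_real r) e) x)"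

definition order_bounds ::
  "(complex \<Rightarrow> 'v::ab_group_add \<Rightarrow> 'v) \<Rightarrow> 'v set \<Rightarrow> 'v \<Rightarrow> 'v \<Rightarrow> real set" where
  "order_bounds scale Vpos e v =
    {r. ge_pos Vpos (scale (complex_of_real r) e + v) 0 \<and>
        ge_pos Vpos (scale (complex_of_real r) e - v) 0}"

text \<open>
  The infimum is over all real \<open>r\<close>. In the zero space, and only there (see
  \<open>order_seminorm_eq_Inf\<close> below), every real is an order bound and the infimum
  would be minus infinity; the seminorm of the zero vector is then taken to be 0.
  The value is meaningful for hermitian \<open>v\<close> only.
\<close>

definition order_seminorm ::
  "(complex \<Rightarrow> 'v::ab_group_add \<Rightarrow> 'v) \<Rightarrow> 'v set \<Rightarrow> 'v \<Rightarrow> 'v \<Rightarrow> real" where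
  "order_seminorm scale Vpos e v =
    (if bdd_below (order_bounds scale Vpos e v) then Inf (order_bounds scale Vpos e v) else 0)"

definition complex_seminorm ::
  "(complex \<Rightarrow> 'v::ab_group_add \<Rightarrow> 'v) \<Rightarrow> ('v \<Rightarrow> real) \<Rightarrow> bool" where
  "complex_seminorm scale N \<longleftrightarrow>
    (\<forall>v. 0 \<le> N v) \<and>
    (\<forall>c v. N (scale c v) = cmod c * N v) \<and>
    (\<forall>v w. N (v + w) \<le> N v + N w)"

definition is_order_seminorm ::
  "(complex \<Rightarrow> 'v::ab_group_add \<Rightarrow> 'v) \<Rightarrow> ('v \<Rightarrow> 'v) \<Rightarrow> 'v set \<Rightarrow> 'v \<Rightarrow> ('v \<Rightarrow> real) \<Rightarrow> bool" where
  "is_order_seminorm scale star Vpos e N \<longleftrightarrow>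
    complex_seminorm scale N \<and>
    (\<forall>v. N (star v) = N v) \<and>
    (\<forall>v \<in> hermitian star. N v = order_seminorm scale Vpos e v)"

definition dec_seminorm ::
  "(complex \<Rightarrow> 'v::ab_group_add \<Rightarrow> 'v) \<Rightarrow> 'v set \<Rightarrow> 'v \<Rightarrow> 'v \<Rightarrow> real" where
  "dec_seminorm scale Vpos e v =
    Inf {order_seminorm scale Vpos e (\<Sum>i=1..n. scale (complex_of_real (cmod (l i))) (p i)) |
           (n::nat) (l::nat \<Rightarrow> complex) (p::nat \<Rightarrow> 'v).
           v = (\<Sum>i=1..n. scale (l i) (p i)) \<and> (\<forall>i\<in>{1..n}. p i \<in> Vpos)}"

context ordered_star_vector_space
begin

lemma star_minus: "star (- v) = - star v"
proof -
  have "star 0 = 0" using star_add[of 0 0] by simp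
  then show ?thesis using star_add[of v "- v"]
    by (simp add: eq_neg_iff_add_eq_0 add.commute)
qed

lemma star_diff: "star (v - w) = star v - star w"
  using star_add[of v "- w"] by (simp add: star_minus)

lemma pos_scale_cancel:
  assumes "scale (complex_of_real r) x \<in> Vpos" "0 < r"
  shows "x \<in> Vpos"
  using pos_scale[of "1 / r" "scale (complex_of_real r) x"] assms
  by (simp flip: of_real_mult)

lemma pos_antisym: "x \<in> Vpos \<Longrightarrow> - x \<in> Vpos \<Longrightarrow> x = 0"
  using pos_proper by (metis IntI add.inverse_inverse imageI singletonD)

lemma order_unit_pos:
  assumes "order_unit scale star Vpos e"
  shows "e \<in> Vpos"
proof -
  have "- e \<in> hermitian star"
    using assms by (simp add: hermitian_def order_unit_def star_minus)
  then obtain t where t: "t > 0" "scale (complex_of_real t) e + e \<in> Vpos"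
    using assms by (auto simp: order_unit_def ge_pos_def)
  moreover have "scale (complex_of_real t) e + e = scale (complex_of_real (t + 1)) e"
    by (simp add: scale_left_distrib)
  ultimately show ?thesis using pos_scale_cancel[of "t + 1" e] by simp
qed

lemma order_bounds_nonempty:
  assumes "order_unit scale star Vpos e" and "v \<in> hermitian star"
  shows "order_bounds scale Vpos e v \<noteq> {}"
proof -
  have mv: "- v \<in> hermitian star" using assms(2) by (simp add: hermitian_def star_minus)
  obtain r where r: "r > 0" "scale (complex_of_real r) e - v \<in> Vpos"
    using assms by (auto simp: order_unit_def ge_pos_def)
  obtain s where s: "s > 0" "scale (complex_of_real s) e + v \<in> Vpos"
    using assms(1) mv by (auto simp: order_unit_def ge_pos_def)
  have "(scale (complex_of_real r) e - v) + scale (complex_of_real s) e \<in> Vpos"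
    "(scale (complex_of_real s) e + v) + scale (complex_of_real r) e \<in> Vpos"
    using r s order_unit_pos[OF assms(1)] by (auto intro!: pos_add pos_scale)
  then have "r + s \<in> order_bounds scale Vpos e v"
    by (simp add: order_bounds_def ge_pos_def scale_left_distrib algebra_simps)
  then show ?thesis by blast
qed

lemma order_unit_nonzero:
  assumes "order_unit scale star Vpos e" and "\<exists>x::'v. x \<noteq> 0"
  shows "e \<noteq> 0"
proof
  assume e: "e = 0"
  have herm0: "h = 0" if "h \<in> hermitian star" for h
  proof -
    have "- h \<in> hermitian star" using that by (simp add: hermitian_def star_minus)
    then have "- h \<in> Vpos" "h \<in> Vpos"
      using assms(1) that by (force simp: order_unit_def ge_pos_def e)+
    then show ?thesis by (rule pos_antisym[rotated])
  qed
  obtain x :: 'v where x: "x \<noteq> 0" using assms(2) by blast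
  have sum: "x + star x = 0"
    by (rule herm0) (simp add: hermitian_def star_add star_star add.commute)
  have "scale \<i> (x - star x) = 0"
    by (rule herm0) (simp add: hermitian_def star_scale star_diff star_star scale_right_diff_distrib)
  then have "x - star x = 0" by (metis scale_eq_0_iff complex_i_not_zero)
  then have "star x = x" by (metis eq_iff_diff_eq_0)
  with sum have "x + x = 0" by metis
  then have "scale 2 x = 0" using scale_left_distrib[of 1 1 x] by simp
  then show False using x by simp
qed

lemma order_seminorm_eq_Inf:
  assumes "order_unit scale star Vpos e" and "\<exists>x::'v. x \<noteq> 0"
  shows "order_seminorm scale Vpos e v = Inf (order_bounds scale Vpos e v)"
proof -
  have "0 \<le> r" if "r \<in> order_bounds scale Vpos e v" for r
  proof (rule ccontr)
    assume "\<not> 0 \<le> r"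
    have "(scale (complex_of_real r) e + v) + (scale (complex_of_real r) e - v) \<in> Vpos"
      by (rule pos_add) (use that in \<open>simp_all add: order_bounds_def ge_pos_def\<close>)
    then have "scale (complex_of_real (- 2 * r)) (- e) \<in> Vpos"
      using scale_left_distrib[of "complex_of_real r" "complex_of_real r" e] by simp
    then have "- e \<in> Vpos" by (rule pos_scale_cancel) (use \<open>\<not> 0 \<le> r\<close> in simp)
    then have "e = 0" using pos_antisym order_unit_pos[OF assms(1)] by blast
    then show False using order_unit_nonzero[OF assms] by blast
  qed
  then have "bdd_below (order_bounds scale Vpos e v)" by (rule bdd_belowI)
  then show ?thesis by (simp add: order_seminorm_def)
qed

end

end

theory Submission
  imports Defs
begin

text \<open>
  Call \<open>u\<close> a majorant of \<open>v\<close> if some decomposition \<open>v = \<Sum> \<lambda>\<^sub>i p\<^sub>i\<close> with positive \<open>p\<^sub>i\<close> has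
  \<open>u = \<Sum> \<bar>\<lambda>\<^sub>i\<bar> p\<^sub>i\<close>, so that the decomposition seminorm of \<open>v\<close> is the infimum of the order
  seminorms of its majorants. Majorants are compatible with addition (concatenate the
  decompositions) and with scalars (\<open>majorant_add\<close>, \<open>majorant_scale\<close>), and every vector has one
  (\<open>majorant_exists\<close>), so the seminorm laws follow from those of the order seminorm. A vector and
  its adjoint have the same majorants (\<open>majorant_star\<close>), which gives the invariance under the
  involution.

  For hermitian \<open>v\<close>, averaging a decomposition with its adjoint replaces the \<open>\<lambda>\<^sub>i\<close> by their real
  parts, and \<open>\<bar>\<lambda>\<^sub>i\<bar> \<plusminus> Re \<lambda>\<^sub>i \<ge> 0\<close> then shows that \<open>u \<plusminus> v\<close> is positive for every majorant \<open>u\<close>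
  (\<open>majorant_dominates\<close>). Hence the order seminorm of \<open>u\<close> is at least that of \<open>v\<close>. Conversely,
  if \<open>r e \<plusminus> v\<close> is positive, the decomposition \<open>v = (r e + v)/2 - (r e - v)/2\<close> has the majorant
  \<open>r e\<close>, whose order seminorm is at most \<open>r\<close> when \<open>r \<ge> 0\<close>.
\<close>

section \<open>Majorants\<close>

text \<open>
  \<open>majorant scale Vpos v u\<close> says that \<open>u\<close> is a majorant of \<open>v\<close>: the pairs \<open>(v, u)\<close> are the finite
  sums of pairs \<open>(\<lambda> p, \<bar>\<lambda>\<bar> p)\<close> with \<open>p\<close> positive. The empty sum is allowed. Different
  decompositions of \<open>v\<close> may give different majorants.
\<close>

definition majorant ::
  "(complex \<Rightarrow> 'v::ab_group_add \<Rightarrow> 'v) \<Rightarrow> 'v set \<Rightarrow> 'v \<Rightarrow> 'v \<Rightarrow> bool" where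
  "majorant scale Vpos v u \<longleftrightarrow>
    (\<exists>(n::nat) l p. v = (\<Sum>i=1..n. scale (l i) (p i)) \<and>
       u = (\<Sum>i=1..n. scale (complex_of_real (cmod (l i))) (p i)) \<and>
       (\<forall>i\<in>{1..n}. p i \<in> Vpos))"

lemma dec_seminorm_eq_Inf_majorants:
  "dec_seminorm scale Vpos e v = Inf (order_seminorm scale Vpos e ` {u. majorant scale Vpos v u})"
proof -
  have "{order_seminorm scale Vpos e (\<Sum>i=1..n. scale (complex_of_real (cmod (l i))) (p i)) |
           (n::nat) (l::nat \<Rightarrow> complex) (p::nat \<Rightarrow> 'a).
           v = (\<Sum>i=1..n. scale (l i) (p i)) \<and> (\<forall>i\<in>{1..n}. p i \<in> Vpos)}
     = order_seminorm scale Vpos e ` {u. majorant scale Vpos v u}"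
    unfolding majorant_def by blast
  then show ?thesis unfolding dec_seminorm_def by simp
qed

context ordered_star_vector_space
begin

lemma zero_pos: "0 \<in> Vpos"
  using pos_proper by blast

lemma pos_sum: "(\<And>i. i \<in> A \<Longrightarrow> f i \<in> Vpos) \<Longrightarrow> sum f A \<in> Vpos"
  by (induction A rule: infinite_finite_induct) (auto simp: zero_pos pos_add)

lemma star_sum: "star (sum f A) = (\<Sum>i\<in>A. star (f i))"
proof -
  have "star 0 = 0" using star_add[of 0 0] by simp
  then show ?thesis
    by (induction A rule: infinite_finite_induct) (auto simp: star_add)
qed

lemma pos_star_eq: "x \<in> Vpos \<Longrightarrow> star x = x"
  using pos_hermitian by (auto simp: hermitian_def)

lemma order_bounds_iff:
  "r \<in> order_bounds scale Vpos e v \<longleftrightarrow>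
    scale (complex_of_real r) e + v \<in> Vpos \<and> scale (complex_of_real r) e - v \<in> Vpos"
  by (simp add: order_bounds_def ge_pos_def)

lemma majorant_single:
  "p \<in> Vpos \<Longrightarrow> majorant scale Vpos (scale c p) (scale (complex_of_real (cmod c)) p)"
  unfolding majorant_def
  by (rule exI[of _ 1], rule exI[of _ "\<lambda>_. c"], rule exI[of _ "\<lambda>_. p"]) simp

lemma majorant_add:
  assumes "majorant scale Vpos v1 u1" "majorant scale Vpos v2 u2"
  shows "majorant scale Vpos (v1 + v2) (u1 + u2)"
proof -
  obtain n1 :: nat and l1 p1 where 1: "v1 = (\<Sum>i=1..n1. scale (l1 i) (p1 i))"
    "u1 = (\<Sum>i=1..n1. scale (complex_of_real (cmod (l1 i))) (p1 i))"
    "\<forall>i\<in>{1..n1}. p1 i \<in> Vpos"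
    using assms(1) unfolding majorant_def by blast
  obtain n2 :: nat and l2 p2 where 2: "v2 = (\<Sum>i=1..n2. scale (l2 i) (p2 i))"
    "u2 = (\<Sum>i=1..n2. scale (complex_of_real (cmod (l2 i))) (p2 i))"
    "\<forall>i\<in>{1..n2}. p2 i \<in> Vpos"
    using assms(2) unfolding majorant_def by blast
  define l where "l i = (if i \<le> n1 then l1 i else l2 (i - n1))" for i
  define p where "p i = (if i \<le> n1 then p1 i else p2 (i - n1))" for i
  have split: "(\<Sum>i=1..n1+n2. scale (h (l i)) (p i))
      = (\<Sum>i=1..n1. scale (h (l1 i)) (p1 i)) + (\<Sum>i=1..n2. scale (h (l2 i)) (p2 i))"
    for h :: "complex \<Rightarrow> complex"
  proof -
    have "(\<Sum>i=1..n1+n2. scale (h (l i)) (p i))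
      = (\<Sum>i=1..n1. scale (h (l i)) (p i)) + (\<Sum>i=n1+1..n1+n2. scale (h (l i)) (p i))"
      by (rule sum.ub_add_nat) simp
    also have "(\<Sum>i=n1+1..n1+n2. scale (h (l i)) (p i))
        = (\<Sum>i=1..n2. scale (h (l (i + n1))) (p (i + n1)))"
      using sum.shift_bounds_cl_nat_ivl[of "\<lambda>i. scale (h (l i)) (p i)" 1 n1 n2]
      by (simp add: add.commute)
    finally show ?thesis by (simp add: l_def p_def)
  qed
  have pos: "\<forall>i\<in>{1..n1+n2}. p i \<in> Vpos"
  proof
    fix i assume "i \<in> {1..n1+n2}"
    then have "i \<in> {1..n1} \<or> \<not> i \<le> n1 \<and> i - n1 \<in> {1..n2}" by auto
    then show "p i \<in> Vpos" using 1(3) 2(3) by (auto simp: p_def)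
  qed
  show ?thesis
    unfolding majorant_def 1(1,2) 2(1,2)
    using split[of "\<lambda>z. z"] split[of "\<lambda>z. complex_of_real (cmod z)"] pos
    by (intro exI[of _ "n1 + n2"] exI[of _ l] exI[of _ p]) simp
qed

lemma majorant_scale:
  assumes "majorant scale Vpos v u"
  shows "majorant scale Vpos (scale c v) (scale (complex_of_real (cmod c)) u)"
proof -
  obtain n :: nat and l p where *: "v = (\<Sum>i=1..n. scale (l i) (p i))"
    "u = (\<Sum>i=1..n. scale (complex_of_real (cmod (l i))) (p i))"
    "\<forall>i\<in>{1..n}. p i \<in> Vpos"
    using assms unfolding majorant_def by blast
  show ?thesis
    unfolding majorant_def *(1,2) using *(3)
    by (intro exI[of _ n] exI[of _ "\<lambda>i. c * l i"] exI[of _ p])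
       (simp add: scale_sum_right norm_mult)
qed

lemma majorant_star:
  assumes "majorant scale Vpos v u"
  shows "majorant scale Vpos (star v) u"
proof -
  obtain n :: nat and l p where *: "v = (\<Sum>i=1..n. scale (l i) (p i))"
    "u = (\<Sum>i=1..n. scale (complex_of_real (cmod (l i))) (p i))"
    "\<forall>i\<in>{1..n}. p i \<in> Vpos"
    using assms unfolding majorant_def by blast
  show ?thesis
    unfolding majorant_def *(1,2) using *(3)
    by (intro exI[of _ n] exI[of _ "\<lambda>i. cnj (l i)"] exI[of _ p])
       (simp add: star_sum star_scale pos_star_eq)
qed

lemma majorant_pos:
  assumes "majorant scale Vpos v u"
  shows "u \<in> Vpos"
  using assms unfolding majorant_def by (auto intro!: pos_sum pos_scale)

text \<open>
  Here \<open>v\<close> is arbitrary: in \<open>2 u + v + star v\<close> the vector \<open>p\<^sub>i\<close> has the coefficient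
  \<open>2 (\<bar>\<lambda>\<^sub>i\<bar> + Re \<lambda>\<^sub>i) \<ge> 0\<close>.
\<close>

lemma majorant_dominates_add_star:
  assumes "majorant scale Vpos v u"
  shows "(u + u) + (v + star v) \<in> Vpos"
proof -
  obtain n :: nat and l p where *: "v = (\<Sum>i=1..n. scale (l i) (p i))"
    "u = (\<Sum>i=1..n. scale (complex_of_real (cmod (l i))) (p i))"
    "\<forall>i\<in>{1..n}. p i \<in> Vpos"
    using assms unfolding majorant_def by blast
  have "star v = (\<Sum>i=1..n. scale (cnj (l i)) (p i))"
    using *(3) by (simp add: *(1) star_sum star_scale pos_star_eq)
  then have "(u + u) + (v + star v) =
      (\<Sum>i=1..n. scale (complex_of_real (cmod (l i)) + complex_of_real (cmod (l i))
                    + (l i + cnj (l i))) (p i))"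
    by (simp only: *(1,2) sum.distrib scale_left_distrib)
  also have "\<dots> = (\<Sum>i=1..n. scale (complex_of_real (2 * (cmod (l i) + Re (l i)))) (p i))"
    by (simp add: complex_add_cnj algebra_simps)
  also have "\<dots> \<in> Vpos"
  proof (rule pos_sum)
    fix i assume "i \<in> {1..n}"
    moreover have "0 \<le> 2 * (cmod (l i) + Re (l i))"
      using abs_Re_le_cmod[of "l i"] by (simp add: abs_le_iff)
    ultimately show "scale (complex_of_real (2 * (cmod (l i) + Re (l i)))) (p i) \<in> Vpos"
      using *(3) pos_scale by blast
  qed
  finally show ?thesis .
qed

lemma majorant_dominates:
  assumes "majorant scale Vpos v u" "v \<in> hermitian star"
  shows "u + v \<in> Vpos" "u - v \<in> Vpos"
proof -
  have main: "u + w \<in> Vpos" if "majorant scale Vpos w u" "star w = w" for w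
  proof -
    have "scale (complex_of_real 2) (u + w) = (u + u) + (w + star w)"
      using scale_left_distrib[of 1 1 "u + w"] that(2) by (simp add: algebra_simps)
    then have "scale (complex_of_real 2) (u + w) \<in> Vpos"
      using majorant_dominates_add_star[OF that(1)] by simp
    then show ?thesis by (rule pos_scale_cancel) simp
  qed
  show "u + v \<in> Vpos" using main assms by (simp add: hermitian_def)
  have "majorant scale Vpos (- v) u"
    using majorant_scale[OF assms(1), of "- 1"] by simp
  then show "u - v \<in> Vpos"
    using main[of "- v"] assms(2) by (simp add: hermitian_def star_minus)
qed

text \<open>The decomposition is \<open>v = (r e + v)/2 - (r e - v)/2\<close>.\<close>

lemma majorant_order_bound:
  assumes "r \<in> order_bounds scale Vpos e v"
  shows "majorant scale Vpos v (scale (complex_of_real r) e)"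
proof -
  let ?re = "scale (complex_of_real r) e"
  have double: "scale (1/2) (x + x) = x" for x
    using scale_left_distrib[of "1/2" "1/2" x] by (simp add: scale_right_distrib)
  have "majorant scale Vpos (scale (1/2) (?re + v) + scale (- 1/2) (?re - v))
          (scale (complex_of_real (cmod (1/2))) (?re + v)
            + scale (complex_of_real (cmod (- 1/2))) (?re - v))"
    using assms by (intro majorant_add majorant_single) (auto simp: order_bounds_iff)
  moreover have "scale (1/2) (?re + v) + scale (- 1/2) (?re - v) = v"
    using double[of v] by (simp add: scale_right_distrib scale_right_diff_distrib)
  moreover have "scale (complex_of_real (cmod (1/2))) (?re + v)
      + scale (complex_of_real (cmod (- 1/2))) (?re - v) = ?re"
    using double[of ?re]
    by (simp add: norm_divide scale_right_distrib scale_right_diff_distrib)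
  ultimately show ?thesis by simp
qed

section \<open>The order seminorm\<close>

context
  fixes e :: 'v
  assumes unit: "order_unit scale star Vpos e"
begin

lemma order_bounds_upward:
  assumes "r \<in> order_bounds scale Vpos e v" "r \<le> s"
  shows "s \<in> order_bounds scale Vpos e v"
proof -
  have "scale (complex_of_real (s - r)) e \<in> Vpos"
    using assms(2) order_unit_pos[OF unit] by (intro pos_scale) auto
  moreover have "scale (complex_of_real r) e + v \<in> Vpos" "scale (complex_of_real r) e - v \<in> Vpos"
    using assms(1) by (auto simp: order_bounds_iff)
  ultimately have
    "scale (complex_of_real (s - r)) e + (scale (complex_of_real r) e + v) \<in> Vpos"
    "scale (complex_of_real (s - r)) e + (scale (complex_of_real r) e - v) \<in> Vpos"
    by (blast intro: pos_add)+
  then show ?thesis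
    by (simp add: order_bounds_iff scale_left_diff_distrib)
qed

text \<open>A negative order bound forces \<open>e = 0\<close>, and then every real is an order bound.\<close>

lemma order_bound_nonneg:
  assumes "bdd_below (order_bounds scale Vpos e v)" "r \<in> order_bounds scale Vpos e v"
  shows "0 \<le> r"
proof (rule ccontr)
  assume neg: "\<not> 0 \<le> r"
  have "(scale (complex_of_real r) e + v) + (scale (complex_of_real r) e - v) \<in> Vpos"
    using assms(2) unfolding order_bounds_iff by (blast intro: pos_add)
  then have "scale (complex_of_real (- 2 * r)) (- e) \<in> Vpos"
    using scale_left_distrib[of "complex_of_real r" "complex_of_real r" e] by simp
  then have "- e \<in> Vpos" by (rule pos_scale_cancel) (use neg in simp)
  then have e: "e = 0" using pos_antisym order_unit_pos[OF unit] by blast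
  obtain m where "\<And>s. s \<in> order_bounds scale Vpos e v \<Longrightarrow> m \<le> s"
    using assms(1) by (auto simp: bdd_below_def)
  moreover have "m - 1 \<in> order_bounds scale Vpos e v"
    using assms(2) by (simp add: order_bounds_iff e)
  ultimately show False by fastforce
qed

lemma order_seminorm_nonneg:
  assumes "v \<in> hermitian star"
  shows "0 \<le> order_seminorm scale Vpos e v"
  using order_bounds_nonempty[OF unit assms] order_bound_nonneg
  by (auto simp: order_seminorm_def intro!: cInf_greatest)

text \<open>
  The condition \<open>0 \<le> r\<close> is needed in the zero space, where the order seminorm vanishes although
  every real is an order bound.
\<close>

lemma order_seminorm_le:
  assumes "r \<in> order_bounds scale Vpos e v" "0 \<le> r"
  shows "order_seminorm scale Vpos e v \<le> r"
  using assms by (auto simp: order_seminorm_def intro: cInf_lower)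

lemma order_bound_if_order_seminorm_less:
  assumes "v \<in> hermitian star" "order_seminorm scale Vpos e v < r"
  shows "r \<in> order_bounds scale Vpos e v"
proof -
  have "\<exists>s\<in>order_bounds scale Vpos e v. s < r"
  proof (cases "bdd_below (order_bounds scale Vpos e v)")
    case True
    then show ?thesis
      using assms order_bounds_nonempty[OF unit assms(1)]
      by (auto simp: order_seminorm_def cInf_less_iff)
  next
    case False
    then show ?thesis by (metis bdd_belowI not_le)
  qed
  then show ?thesis using order_bounds_upward by (meson less_imp_le)
qed

lemma order_seminorm_triangle:
  assumes "x \<in> hermitian star" "y \<in> hermitian star"
  shows "order_seminorm scale Vpos e (x + y)
    \<le> order_seminorm scale Vpos e x + order_seminorm scale Vpos e y"
proof (rule field_le_epsilon)
  fix d :: real assume d: "0 < d"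
  let ?r = "order_seminorm scale Vpos e x + d/2"
  let ?s = "order_seminorm scale Vpos e y + d/2"
  have "?r \<in> order_bounds scale Vpos e x" "?s \<in> order_bounds scale Vpos e y"
    using d assms by (auto intro: order_bound_if_order_seminorm_less)
  then have
    "(scale (complex_of_real ?r) e + x) + (scale (complex_of_real ?s) e + y) \<in> Vpos"
    "(scale (complex_of_real ?r) e - x) + (scale (complex_of_real ?s) e - y) \<in> Vpos"
    unfolding order_bounds_iff by (blast intro: pos_add)+
  moreover have "scale (complex_of_real (?r + ?s)) e
      = scale (complex_of_real ?r) e + scale (complex_of_real ?s) e"
    by (simp only: of_real_add scale_left_distrib)
  ultimately have "?r + ?s \<in> order_bounds scale Vpos e (x + y)"
    unfolding order_bounds_iff by (simp only: algebra_simps)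
  then have "order_seminorm scale Vpos e (x + y) \<le> ?r + ?s"
    using order_seminorm_nonneg assms d by (intro order_seminorm_le) auto
  then show "order_seminorm scale Vpos e (x + y)
    \<le> order_seminorm scale Vpos e x + order_seminorm scale Vpos e y + d" by simp
qed

text \<open>
  The infimum defining the order seminorm need not be attained, so the inequality is
  stated for every \<open>r\<close> strictly above the seminorm.
\<close>

lemma order_seminorm_scale_le:
  assumes "x \<in> hermitian star" "0 \<le> c" "order_seminorm scale Vpos e x < r"
  shows "order_seminorm scale Vpos e (scale (complex_of_real c) x) \<le> c * r"
proof -
  have "r \<in> order_bounds scale Vpos e x"
    using assms order_bound_if_order_seminorm_less by blast
  then have "scale (complex_of_real c) (scale (complex_of_real r) e + x) \<in> Vpos"
    "scale (complex_of_real c) (scale (complex_of_real r) e - x) \<in> Vpos"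
    using assms(2) by (auto simp: order_bounds_iff intro!: pos_scale)
  then have "c * r \<in> order_bounds scale Vpos e (scale (complex_of_real c) x)"
    by (simp add: order_bounds_iff scale_right_distrib scale_right_diff_distrib)
  moreover have "0 \<le> r" using order_seminorm_nonneg[OF assms(1)] assms(3) by simp
  ultimately show ?thesis using assms(2) by (intro order_seminorm_le) auto
qed

text \<open>Monotonicity: if \<open>- u \<le> v \<le> u\<close>, every order bound of \<open>u\<close> is one of \<open>v\<close>.\<close>

lemma order_seminorm_mono:
  assumes "u \<in> hermitian star" "u + v \<in> Vpos" "u - v \<in> Vpos"
  shows "order_seminorm scale Vpos e v \<le> order_seminorm scale Vpos e u"
proof (rule dense_ge)
  fix r assume r: "order_seminorm scale Vpos e u < r"
  then have "scale (complex_of_real r) e - u \<in> Vpos"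
    using order_bound_if_order_seminorm_less[OF assms(1)] by (auto simp: order_bounds_iff)
  then have "(scale (complex_of_real r) e - u) + (u + v) \<in> Vpos"
    "(scale (complex_of_real r) e - u) + (u - v) \<in> Vpos"
    using assms(2,3) by (blast intro: pos_add)+
  then have "r \<in> order_bounds scale Vpos e v"
    by (simp add: order_bounds_iff algebra_simps)
  moreover have "0 \<le> r" using order_seminorm_nonneg[OF assms(1)] r by simp
  ultimately show "order_seminorm scale Vpos e v \<le> r" by (rule order_seminorm_le)
qed

section \<open>The decomposition seminorm\<close>

lemma majorant_exists: "\<exists>u. majorant scale Vpos v u"
proof -
  have herm: "\<exists>u. majorant scale Vpos h u" if "h \<in> hermitian star" for h
    using order_bounds_nonempty[OF unit that] majorant_order_bound by blast
  \<comment> \<open>Twice the real part of \<open>v\<close>, and minus twice its imaginary part.\<close>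
  let ?a = "v + star v" and ?b = "scale \<i> (v - star v)"
  have "?a \<in> hermitian star"
    by (simp add: hermitian_def star_add star_star add.commute)
  then obtain ua where ua: "majorant scale Vpos ?a ua" using herm by blast
  have "?b \<in> hermitian star"
    by (simp add: hermitian_def star_scale star_diff star_star scale_right_diff_distrib)
  then obtain ub where ub: "majorant scale Vpos ?b ub" using herm by blast
  have "scale (1/2) ?a + scale (- \<i>/2) ?b = v"
    using scale_left_distrib[of "1/2" "1/2" v]
    by (simp add: scale_right_distrib scale_right_diff_distrib)
  then show ?thesis
    using majorant_add[OF majorant_scale[OF ua, of "1/2"] majorant_scale[OF ub, of "- \<i>/2"]]
    by auto
qed

lemma majorant_hermitian: "majorant scale Vpos v u \<Longrightarrow> u \<in> hermitian star"
  using majorant_pos pos_hermitian by blast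

lemma dec_seminorm_le:
  assumes "majorant scale Vpos v u"
  shows "dec_seminorm scale Vpos e v \<le> order_seminorm scale Vpos e u"
  unfolding dec_seminorm_eq_Inf_majorants
proof (rule cInf_lower)
  show "bdd_below (order_seminorm scale Vpos e ` {u. majorant scale Vpos v u})"
    by (rule bdd_belowI[of _ 0]) (auto intro: order_seminorm_nonneg majorant_hermitian)
qed (use assms in auto)

lemma dec_seminorm_greatest:
  assumes "\<And>u. majorant scale Vpos v u \<Longrightarrow> b \<le> order_seminorm scale Vpos e u"
  shows "b \<le> dec_seminorm scale Vpos e v"
  unfolding dec_seminorm_eq_Inf_majorants
  using assms majorant_exists[of v] by (intro cInf_greatest) auto

lemma dec_seminorm_lessE:
  assumes "dec_seminorm scale Vpos e v < r"
  obtains u where "majorant scale Vpos v u" "order_seminorm scale Vpos e u < r"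
  using dec_seminorm_greatest[of v r] assms by (meson not_le)

lemma dec_seminorm_nonneg: "0 \<le> dec_seminorm scale Vpos e v"
  by (intro dec_seminorm_greatest order_seminorm_nonneg majorant_hermitian)

lemma dec_seminorm_triangle:
  "dec_seminorm scale Vpos e (v + w) \<le> dec_seminorm scale Vpos e v + dec_seminorm scale Vpos e w"
proof (rule field_le_epsilon)
  fix d :: real assume "0 < d"
  then have "dec_seminorm scale Vpos e v < dec_seminorm scale Vpos e v + d/2"
    "dec_seminorm scale Vpos e w < dec_seminorm scale Vpos e w + d/2" by auto
  then obtain x y where
    x: "majorant scale Vpos v x"
      "order_seminorm scale Vpos e x < dec_seminorm scale Vpos e v + d/2" and
    y: "majorant scale Vpos w y"
      "order_seminorm scale Vpos e y < dec_seminorm scale Vpos e w + d/2"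
    by (meson dec_seminorm_lessE)
  have "dec_seminorm scale Vpos e (v + w) \<le> order_seminorm scale Vpos e (x + y)"
    by (intro dec_seminorm_le majorant_add x y)
  also have "\<dots> \<le> order_seminorm scale Vpos e x + order_seminorm scale Vpos e y"
    using x(1) y(1) by (intro order_seminorm_triangle majorant_hermitian)
  finally show "dec_seminorm scale Vpos e (v + w)
      \<le> dec_seminorm scale Vpos e v + dec_seminorm scale Vpos e w + d"
    using x(2) y(2) by simp
qed

lemma dec_seminorm_scale_le:
  "dec_seminorm scale Vpos e (scale c v) \<le> cmod c * dec_seminorm scale Vpos e v"
proof (rule field_le_epsilon)
  fix d :: real assume d: "0 < d"
  \<comment> \<open>The excess \<open>k\<close> satisfies \<open>\<bar>c\<bar> k \<le> d\<close>, also for \<open>c = 0\<close>.\<close>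
  define k where "k = d / (cmod c + 1)"
  have den: "0 < cmod c + 1" by (simp add: add_nonneg_pos)
  then have k: "0 < k" "cmod c * k \<le> d"
    using d by (auto simp: k_def field_simps)
  obtain u where u: "majorant scale Vpos v u"
    "order_seminorm scale Vpos e u < dec_seminorm scale Vpos e v + k"
    using dec_seminorm_lessE[of v "dec_seminorm scale Vpos e v + k"] k(1) by auto
  have "dec_seminorm scale Vpos e (scale c v)
      \<le> order_seminorm scale Vpos e (scale (complex_of_real (cmod c)) u)"
    by (intro dec_seminorm_le majorant_scale u)
  also have "\<dots> \<le> cmod c * (dec_seminorm scale Vpos e v + k)"
    by (intro order_seminorm_scale_le majorant_hermitian[OF u(1)] u(2)) simp
  finally show "dec_seminorm scale Vpos e (scale c v) \<le> cmod c * dec_seminorm scale Vpos e v + d"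
    using k(2) by (simp add: algebra_simps)
qed

lemma dec_seminorm_scale:
  "dec_seminorm scale Vpos e (scale c v) = cmod c * dec_seminorm scale Vpos e v"
proof (cases "c = 0")
  case True
  then show ?thesis
    using dec_seminorm_scale_le[of c v] dec_seminorm_nonneg[of "scale c v"] by simp
next
  case False
  have "dec_seminorm scale Vpos e v \<le> cmod (inverse c) * dec_seminorm scale Vpos e (scale c v)"
    using dec_seminorm_scale_le[of "inverse c" "scale c v"] False by simp
  then have "cmod c * dec_seminorm scale Vpos e v \<le> dec_seminorm scale Vpos e (scale c v)"
    using False by (simp add: norm_divide field_simps)
  with dec_seminorm_scale_le[of c v] show ?thesis by simp
qed

lemma dec_seminorm_star: "dec_seminorm scale Vpos e (star v) = dec_seminorm scale Vpos e v"
proof -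
  have "majorant scale Vpos (star v) = majorant scale Vpos v"
    using majorant_star[of v] majorant_star[of "star v"] by (auto simp: star_star)
  then show ?thesis by (simp add: dec_seminorm_eq_Inf_majorants)
qed

lemma dec_seminorm_hermitian:
  assumes "v \<in> hermitian star"
  shows "dec_seminorm scale Vpos e v = order_seminorm scale Vpos e v"
proof (rule antisym)
  show "order_seminorm scale Vpos e v \<le> dec_seminorm scale Vpos e v"
    using assms majorant_hermitian majorant_dominates
    by (intro dec_seminorm_greatest order_seminorm_mono)
  show "dec_seminorm scale Vpos e v \<le> order_seminorm scale Vpos e v"
  proof (rule dense_ge)
    fix r assume r: "order_seminorm scale Vpos e v < r"
    then have r0: "0 \<le> r" using order_seminorm_nonneg[OF assms] by simp
    have "r \<in> order_bounds scale Vpos e v"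
      using assms r by (rule order_bound_if_order_seminorm_less)
    then have "dec_seminorm scale Vpos e v \<le> order_seminorm scale Vpos e (scale (complex_of_real r) e)"
      by (intro dec_seminorm_le majorant_order_bound)
    also have "\<dots> \<le> r"
    proof (rule order_seminorm_le)
      have "scale (complex_of_real (2 * r)) e \<in> Vpos"
        using r0 order_unit_pos[OF unit] by (intro pos_scale) auto
      then show "r \<in> order_bounds scale Vpos e (scale (complex_of_real r) e)"
        using zero_pos scale_left_distrib[of "complex_of_real r" "complex_of_real r" e]
        by (simp add: order_bounds_iff)
    qed (rule r0)
    finally show "dec_seminorm scale Vpos e v \<le> r" .
  qed
qed

end

end

theorem proposition4p19:
  fixes scale :: "complex \<Rightarrow> 'v::ab_group_add \<Rightarrow> 'v"
    and star :: "'v \<Rightarrow> 'v"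
    and Vpos :: "'v set"
    and e :: 'v
  assumes "ordered_star_vector_space scale star Vpos"
    and "order_unit scale star Vpos e"
  shows "is_order_seminorm scale star Vpos e (dec_seminorm scale Vpos e)"
proof -
  interpret ordered_star_vector_space scale star Vpos by (rule assms(1))
  note u = assms(2)
  show ?thesis
    unfolding is_order_seminorm_def complex_seminorm_def
    using dec_seminorm_nonneg[OF u] dec_seminorm_scale[OF u] dec_seminorm_triangle[OF u]
      dec_seminorm_star[OF u] dec_seminorm_hermitian[OF u]
    by blast
qed

end
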